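(* Let $h:\mathbb{R}^n\to\mathbb{R}$ be differentiable with $L$-Lipschitz continuous gradient ($L>0$) and strongly quasiconvex with modulus $\gamma>0$, and let $\overline{x}$ be its unique minimizer on $\mathbb{R}^n$. Suppose that $$\alpha\in\left[0,\tfrac{\sqrt2}{2}\right[,\quad \theta\in\left[0,\tfrac{\alpha}{L\sqrt3}\right[,\quad \beta>\theta(\sqrt2-1),\quad \theta+\beta\in\left]0,\tfrac{1-2\alpha^2}{L}\right].$$ Then the sequence $\{x_k\}_k$ generated by the Heavy Ball method with Hessian correction $$y_k=x_k+\alpha(x_k-x_{k-1})-\theta\left(\nabla h(x_k)-\nabla h(x_{k-1})\right),\qquad x_{k+1}=y_k-\beta\nabla h(x_k)\qquad(k\ge0)$$ from arbitrary starting points $x_{-1},x_0\in\mathbb{R}^n$ converges linearly to $\overline{x}$, and the sequence $\{h(x_k)\}_k$ converges linearly to the optimal value $h^*=h(\overline{x})$.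
   Context: $\|\cdot\|$ is the Euclidean norm on $\mathbb{R}^n$. A function $h:\mathbb{R}^n\to\mathbb{R}$ is strongly quasiconvex with modulus $\gamma>0$ if for all $x,y\in\mathbb{R}^n$ and $\lambda\in[0,1]$, $$h(\lambda y+(1-\lambda)x)\le\max\{h(y),h(x)\}-\lambda(1-\lambda)\frac{\gamma}{2}\|x-y\|^2.$$ It is known that a lower semicontinuous strongly quasiconvex function on $\mathbb{R}^n$ has exactly one minimizer. A sequence $\{z_k\}_k$ converges linearly to $z$ if there exist $C\ge0$ and $q\in\,]0,1[$ such that $\|z_k-z\|\le Cq^k$ for all $k\ge 0$. The half-open interval for $\theta$ is empty when $\alpha=0$, so the parameter condition forces $\alpha>0$. The method is considered with constant parameters $\alpha\in[0,1]$, $\theta\ge0$, $\beta>0$. *)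

theory Defs
  imports "HOL-Analysis.Analysis"
begin

definition gradient :: "('a::real_inner \<Rightarrow> real) \<Rightarrow> 'a \<Rightarrow> 'a" where
  "gradient h x = (THE D. GDERIV h x :> D)"

text \<open>The value of \<open>gradient\<close> is meaningful only at points of differentiability.\<close>

lemma GDERIV_gradient:
  fixes h :: "'a::euclidean_space \<Rightarrow> real"
  assumes "h differentiable (at x)"
  shows "GDERIV h x :> gradient h x"
proof -
  obtain f' where f': "(h has_derivative f') (at x)"
    using assms by (auto simp: differentiable_def)
  have lin: "linear f'"
    using f' by (rule has_derivative_linear)
  have rep: "f' = (\<lambda>v. v \<bullet> adjoint f' 1)"
    using adjoint_works[OF lin, of _ 1] by (simp add: fun_eq_iff inner_commute)
  have ex: "GDERIV h x :> adjoint f' 1"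
    unfolding gderiv_def using f' rep by simp
  have "D = adjoint f' 1" if "GDERIV h x :> D" for D
  proof -
    have "(\<lambda>v. v \<bullet> D) = (\<lambda>v. v \<bullet> adjoint f' 1)"
      using that ex unfolding gderiv_def by (rule has_derivative_unique)
    then have "\<And>v. v \<bullet> D = v \<bullet> adjoint f' 1"
      by (simp add: fun_eq_iff)
    then show ?thesis
      using vector_eq_ldot by blast
  qed
  with ex show ?thesis
    unfolding gradient_def by (rule theI)
qed

definition strongly_quasiconvex :: "real \<Rightarrow> ('a::real_normed_vector \<Rightarrow> real) \<Rightarrow> bool" where
  "strongly_quasiconvex \<gamma> h \<longleftrightarrow>
     (\<forall>x y. \<forall>t\<in>{0..1}. h (t *\<^sub>R y + (1 - t) *\<^sub>R x)
        \<le> max (h y) (h x) - t * (1 - t) * (\<gamma> / 2) * (norm (x - y))\<^sup>2)"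

definition converges_linearly :: "(nat \<Rightarrow> 'a::real_normed_vector) \<Rightarrow> 'a \<Rightarrow> bool" where
  "converges_linearly z l \<longleftrightarrow>
     (\<exists>C\<ge>0. \<exists>q\<in>{0<..<1}. \<forall>k. norm (z k - l) \<le> C * q ^ k)"

end

theory Submission
  imports Defs
begin

text \<open>
  Write \<open>d\<^sub>k = x\<^sub>k - x\<^sub>k\<^sub>-\<^sub>1\<close> and \<open>g\<^sub>k = \<nabla>h(x\<^sub>k)\<close>. The method reads \<open>d\<^sub>k\<^sub>+\<^sub>1 = w\<^sub>k - \<beta> g\<^sub>k\<close>, where the
  inertial term \<open>w\<^sub>k = \<alpha> d\<^sub>k - \<theta> (g\<^sub>k - g\<^sub>k\<^sub>-\<^sub>1)\<close> has norm at most \<open>\<rho> \<parallel>d\<^sub>k\<parallel>\<close> with \<open>\<rho> = \<alpha> + \<theta> L\<close>.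
  Thus it behaves like a heavy ball method with momentum \<open>\<rho>\<close>, and the classical condition
  \<open>\<rho> + L \<beta> / 2 < 1\<close> for that method follows from the bounds on the parameters
  (\<open>momentum_bound\<close>).

  Under this condition the energy \<open>h(x\<^sub>k) - h\<^sup>* + c \<parallel>d\<^sub>k\<parallel>\<^sup>2\<close> drops in each step by at least a
  multiple of \<open>\<parallel>d\<^sub>k\<parallel>\<^sup>2 + \<parallel>d\<^sub>k\<^sub>+\<^sub>1\<parallel>\<^sup>2\<close>: this is the descent lemma for functions with Lipschitz
  gradient, into which \<open>g\<^sub>k = (w\<^sub>k - d\<^sub>k\<^sub>+\<^sub>1) / \<beta>\<close> is substituted (\<open>energy_decrease\<close>).

  Strong quasiconvexity gives \<open>\<parallel>g\<^sub>k\<parallel> \<ge> \<gamma>/2 \<parallel>x\<^sub>k - x\<^sup>*\<parallel>\<close>, and with smoothness the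
  Polyak-Lojasiewicz inequality \<open>h(x\<^sub>k) - h\<^sup>* \<le> (2 L / \<gamma>\<^sup>2) \<parallel>g\<^sub>k\<parallel>\<^sup>2\<close>. As \<open>\<beta> g\<^sub>k = w\<^sub>k - d\<^sub>k\<^sub>+\<^sub>1\<close>,
  the whole energy is at most a multiple of \<open>\<parallel>d\<^sub>k\<parallel>\<^sup>2 + \<parallel>d\<^sub>k\<^sub>+\<^sub>1\<parallel>\<^sup>2\<close>, that is, of its own
  decrease, so it contracts by a fixed factor (\<open>energy_contraction\<close>). The energy dominates
  the gap \<open>h(x\<^sub>k) - h\<^sup>*\<close>, and the gap dominates \<open>\<gamma>/8 \<parallel>x\<^sub>k - x\<^sup>*\<parallel>\<^sup>2\<close> by strong quasiconvexity
  at the midpoint of \<open>x\<^sub>k\<close> and \<open>x\<^sup>*\<close>.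
\<close>

section \<open>Functions with Lipschitz continuous gradient\<close>

lemma GDERIV_along_line:
  fixes h :: "'a::real_inner \<Rightarrow> real"
  assumes "GDERIV h (x + t *\<^sub>R v) :> D"
  shows "((\<lambda>s. h (x + s *\<^sub>R v)) has_real_derivative v \<bullet> D) (at t)"
proof -
  have 1: "((\<lambda>s::real. x + s *\<^sub>R v) has_derivative (\<lambda>s. s *\<^sub>R v)) (at t)"
    by (auto intro!: derivative_eq_intros)
  have 2: "(h has_derivative (\<lambda>u. u \<bullet> D)) (at (x + t *\<^sub>R v))"
    using assms by (simp add: gderiv_def)
  have "((\<lambda>s. h (x + s *\<^sub>R v)) has_derivative (\<lambda>s. (s *\<^sub>R v) \<bullet> D)) (at t)"
    using has_derivative_compose[OF 1 2] by simp
  then show ?thesis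
    by (simp add: has_field_derivative_def mult_commute_abs)
qed

text \<open>
  The derivative of \<open>h\<close> on the segment from \<open>x\<close> to \<open>y\<close> differs from its initial value by at
  most \<open>t L \<parallel>y - x\<parallel>\<^sup>2\<close> at time \<open>t\<close>; integrating produces the factor \<open>L / 2\<close>. Comparing
  derivatives avoids the integral.
\<close>

lemma descent_lemma:
  fixes h :: "'a::real_inner \<Rightarrow> real"
  assumes G: "\<And>z. GDERIV h z :> G z" and lip: "L-lipschitz_on UNIV G"
  shows "h y \<le> h x + (y - x) \<bullet> G x + L / 2 * (norm (y - x))\<^sup>2"
proof -
  define v where "v = y - x"
  define \<phi> where "\<phi> t = h (x + t *\<^sub>R v) - t * (v \<bullet> G x) - L / 2 * t\<^sup>2 * (norm v)\<^sup>2" for t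
  have der: "(\<phi> has_real_derivative v \<bullet> G (x + t *\<^sub>R v) - v \<bullet> G x - L * t * (norm v)\<^sup>2) (at t)" for t
    unfolding \<phi>_def
    by (rule derivative_eq_intros GDERIV_along_line[OF G] refl | simp)+
  have nonpos: "v \<bullet> G (x + t *\<^sub>R v) - v \<bullet> G x - L * t * (norm v)\<^sup>2 \<le> 0" if "0 \<le> t" for t
  proof -
    have "v \<bullet> G (x + t *\<^sub>R v) - v \<bullet> G x = v \<bullet> (G (x + t *\<^sub>R v) - G x)"
      by (simp add: inner_diff_right)
    also have "\<dots> \<le> norm v * norm (G (x + t *\<^sub>R v) - G x)"
      by (rule norm_cauchy_schwarz)
    also have "\<dots> \<le> norm v * (L * norm (t *\<^sub>R v))"
      using lipschitz_onD[OF lip, of "x + t *\<^sub>R v" x]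
      by (intro mult_left_mono) (auto simp: dist_norm)
    also have "\<dots> = L * t * (norm v)\<^sup>2"
      using that by (simp add: power2_eq_square)
    finally show ?thesis by simp
  qed
  have "\<phi> 1 \<le> \<phi> 0"
  proof (rule DERIV_nonpos_imp_nonincreasing[of 0 1 \<phi>])
    show "\<exists>D. (\<phi> has_real_derivative D) (at t) \<and> D \<le> 0" if "0 \<le> t" for t
      using der[of t] nonpos[OF that] by (intro exI conjI)
  qed simp
  then show ?thesis
    by (simp add: \<phi>_def v_def)
qed

lemma gradient_at_minimizer:
  fixes h :: "'a::real_inner \<Rightarrow> real"
  assumes G: "\<And>z. GDERIV h z :> G z" and lip: "L-lipschitz_on UNIV G" and "L > 0"
    and min: "\<And>z. h m \<le> h z"
  shows "G m = 0"
proof -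
  \<comment> \<open>A gradient step of length \<open>1 / L\<close> decreases \<open>h\<close> by at least \<open>\<parallel>G m\<parallel>\<^sup>2 / (2 L)\<close>.\<close>
  define z where "z = m - (1 / L) *\<^sub>R G m"
  have "h m \<le> h z" by (rule min)
  also have "h z \<le> h m + (z - m) \<bullet> G m + L / 2 * (norm (z - m))\<^sup>2"
    by (rule descent_lemma[OF G lip])
  also have "\<dots> = h m - (norm (G m))\<^sup>2 / (2 * L)"
    using \<open>L > 0\<close>
    by (simp add: z_def dot_square_norm power_divide power2_eq_square)
  finally have "(norm (G m))\<^sup>2 / (2 * L) \<le> 0" by simp
  then show ?thesis
    using \<open>L > 0\<close> by (simp add: divide_le_0_iff)
qed

section \<open>Strong quasiconvexity\<close>

text \<open>
  Along the segment from \<open>x\<close> to \<open>m\<close>, the function \<open>h\<close> plus the quadratic bonus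
  \<open>t (1 - t) \<gamma>/2 \<parallel>x - m\<parallel>\<^sup>2\<close> never exceeds its value at \<open>t = 0\<close>, so its derivative there
  cannot be positive.
\<close>

lemma strongly_quasiconvex_gradient_inner:
  fixes h :: "'a::real_inner \<Rightarrow> real"
  assumes sqc: "strongly_quasiconvex \<gamma> h" and G: "GDERIV h x :> D" and le: "h m \<le> h x"
  shows "\<gamma> / 2 * (norm (x - m))\<^sup>2 \<le> (x - m) \<bullet> D"
proof (rule ccontr)
  assume neg: "\<not> ?thesis"
  define v where "v = m - x"
  define \<phi> where "\<phi> t = h (x + t *\<^sub>R v) + t * (1 - t) * (\<gamma> / 2 * (norm v)\<^sup>2)" for t
  have "GDERIV h (x + 0 *\<^sub>R v) :> D" using G by simp
  note line = GDERIV_along_line[OF this]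
  have der: "(\<phi> has_real_derivative v \<bullet> D + \<gamma> / 2 * (norm v)\<^sup>2) (at 0)"
    unfolding \<phi>_def by (rule derivative_eq_intros line refl | simp)+
  have "v \<bullet> D = - ((x - m) \<bullet> D)" "norm v = norm (x - m)"
    by (simp_all add: v_def norm_minus_commute inner_diff_left)
  then have "0 < v \<bullet> D + \<gamma> / 2 * (norm v)\<^sup>2" using neg by simp
  from DERIV_pos_inc_right[OF der this]
  obtain e where e: "e > 0" "\<And>s. 0 < s \<Longrightarrow> s < e \<Longrightarrow> \<phi> 0 < \<phi> s" by auto
  define s where "s = min (e / 2) 1"
  have s: "0 < s" "s < e" "s \<in> {0..1}" using e(1) by (auto simp: s_def)
  have "h (s *\<^sub>R m + (1 - s) *\<^sub>R x) \<le> max (h m) (h x) - s * (1 - s) * (\<gamma> / 2) * (norm (x - m))\<^sup>2"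
    using sqc s(3) unfolding strongly_quasiconvex_def by blast
  moreover have "s *\<^sub>R m + (1 - s) *\<^sub>R x = x + s *\<^sub>R v"
    by (simp add: v_def algebra_simps)
  ultimately have "\<phi> s \<le> \<phi> 0"
    using le by (simp add: \<phi>_def v_def norm_minus_commute)
  with e(2)[OF s(1,2)] show False by simp
qed

lemma strongly_quasiconvex_quadratic_growth:
  fixes h :: "'a::real_normed_vector \<Rightarrow> real"
  assumes sqc: "strongly_quasiconvex \<gamma> h" and min: "\<And>z. h m \<le> h z"
  shows "\<gamma> / 8 * (norm (x - m))\<^sup>2 \<le> h x - h m"
proof -
  have "(1 / 2 :: real) \<in> {0..1}" by simp
  then have "h ((1/2) *\<^sub>R m + (1 - 1/2) *\<^sub>R x)
      \<le> max (h m) (h x) - 1/2 * (1 - 1/2) * (\<gamma> / 2) * (norm (x - m))\<^sup>2"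
    using sqc unfolding strongly_quasiconvex_def by blast
  then show ?thesis
    using min[of x] min[of "(1/2) *\<^sub>R m + (1 - 1/2) *\<^sub>R x"] by simp
qed

text \<open>
  Smoothness at the minimizer bounds the gap by \<open>L/2 \<parallel>x - m\<parallel>\<^sup>2\<close>, and Cauchy-Schwarz turns
  \<open>strongly_quasiconvex_gradient_inner\<close> into \<open>\<gamma>/2 \<parallel>x - m\<parallel> \<le> \<parallel>G x\<parallel>\<close>.
\<close>

lemma strongly_quasiconvex_polyak_lojasiewicz:
  fixes h :: "'a::real_inner \<Rightarrow> real"
  assumes G: "\<And>z. GDERIV h z :> G z" and lip: "L-lipschitz_on UNIV G" and "L > 0"
    and "\<gamma> > 0" and sqc: "strongly_quasiconvex \<gamma> h" and min: "\<And>z. h m \<le> h z"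
  shows "h x - h m \<le> 2 * L / \<gamma>\<^sup>2 * (norm (G x))\<^sup>2"
proof -
  have "\<gamma> / 2 * (norm (x - m))\<^sup>2 \<le> (x - m) \<bullet> G x"
    by (rule strongly_quasiconvex_gradient_inner[OF sqc G min])
  also have "\<dots> \<le> norm (x - m) * norm (G x)"
    by (rule norm_cauchy_schwarz)
  finally have "norm (x - m) * (\<gamma> / 2 * norm (x - m)) \<le> norm (x - m) * norm (G x)"
    by (simp add: power2_eq_square mult_ac)
  then have "\<gamma> / 2 * norm (x - m) \<le> norm (G x)"
    by (cases "x = m") (auto simp: mult_le_cancel_left_pos)
  then have "norm (x - m) \<le> 2 / \<gamma> * norm (G x)"
    using \<open>\<gamma> > 0\<close> by (simp add: field_simps)
  then have *: "(norm (x - m))\<^sup>2 \<le> (2 / \<gamma> * norm (G x))\<^sup>2"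
    by (intro power_mono) auto
  have "h x - h m \<le> L / 2 * (norm (x - m))\<^sup>2"
    using descent_lemma[OF G lip, of x m] gradient_at_minimizer[OF G lip \<open>L > 0\<close> min] by simp
  also have "\<dots> \<le> L / 2 * (2 / \<gamma> * norm (G x))\<^sup>2"
    using * \<open>L > 0\<close> by (intro mult_left_mono) auto
  also have "\<dots> = 2 * L / \<gamma>\<^sup>2 * (norm (G x))\<^sup>2"
    by (simp add: power_mult_distrib power_divide)
  finally show ?thesis .
qed

section \<open>Decrease and contraction of the energy\<close>

text \<open>
  Substituting \<open>G z = (w - (z' - z)) / \<beta>\<close> in the descent lemma leaves the mixed term
  \<open>w \<bullet> (z' - z) / \<beta>\<close>, which the bound on \<open>w\<close> splits evenly between the old and the new
  increment. The weight \<open>(2 - L \<beta>) / (4 \<beta>)\<close> is the one for which both increments gain the same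
  coefficient, and this coefficient is positive exactly when \<open>\<rho> + L \<beta> / 2 < 1\<close>.
\<close>

lemma energy_decrease:
  fixes h :: "'a::real_inner \<Rightarrow> real" and d :: 'a
  assumes G: "\<And>z. GDERIV h z :> G z" and lip: "L-lipschitz_on UNIV G"
    and "\<beta> > 0" and w: "norm w \<le> \<rho> * norm d" and "0 \<le> \<rho>"
    and step: "z' - z = w - \<beta> *\<^sub>R G z"
  shows "h z' + (2 - L * \<beta>) / (4 * \<beta>) * (norm (z' - z))\<^sup>2
    \<le> h z + (2 - L * \<beta>) / (4 * \<beta>) * (norm d)\<^sup>2
      - (2 - L * \<beta> - 2 * \<rho>) / (4 * \<beta>) * ((norm d)\<^sup>2 + (norm (z' - z))\<^sup>2)"
proof -
  define u where "u = z' - z"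
  define c e where "c = (2 - L * \<beta>) / (4 * \<beta>)" and "e = \<rho> / (2 * \<beta>)"
  have coeff: "(2 - L * \<beta> - 2 * \<rho>) / (4 * \<beta>) = c - e"
    using \<open>\<beta> > 0\<close> by (simp add: c_def e_def diff_divide_distrib)
  have smooth: "L / 2 = 1 / \<beta> - 2 * c"
    using \<open>\<beta> > 0\<close> by (simp add: c_def diff_divide_distrib)
  define a b where "a = norm d" and "b = norm u"
  have "u \<bullet> w \<le> b * norm w"
    unfolding b_def by (rule norm_cauchy_schwarz)
  also have "\<dots> \<le> b * (\<rho> * a)"
    using w by (intro mult_left_mono) (auto simp: a_def b_def)
  also have "\<dots> = \<rho> * (a * b)" by simp
  also have "\<dots> \<le> \<rho> * ((a\<^sup>2 + b\<^sup>2) / 2)"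
    using sum_squares_bound[of a b] \<open>0 \<le> \<rho>\<close> by (intro mult_left_mono) auto
  finally have mixed: "u \<bullet> w \<le> \<rho> * ((a\<^sup>2 + b\<^sup>2) / 2)" .
  have grad: "\<beta> *\<^sub>R G z = w - u" using step by (simp add: u_def)
  have "\<beta> * (u \<bullet> G z) = u \<bullet> (\<beta> *\<^sub>R G z)" by simp
  also have "\<dots> = u \<bullet> w - b\<^sup>2"
    unfolding grad inner_diff_right b_def power2_norm_eq_inner ..
  finally have "u \<bullet> G z = (u \<bullet> w - b\<^sup>2) / \<beta>"
    using \<open>\<beta> > 0\<close> by (simp add: eq_divide_eq mult.commute)
  also have "\<dots> \<le> (\<rho> * ((a\<^sup>2 + b\<^sup>2) / 2) - b\<^sup>2) / \<beta>"
    using mixed \<open>\<beta> > 0\<close> by (intro divide_right_mono) auto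
  also have "\<dots> = e * (a\<^sup>2 + b\<^sup>2) - 1 / \<beta> * b\<^sup>2"
    by (simp add: e_def diff_divide_distrib)
  finally have "h z' \<le> h z + (e * (a\<^sup>2 + b\<^sup>2) - 1 / \<beta> * b\<^sup>2) + (1 / \<beta> - 2 * c) * b\<^sup>2"
    using descent_lemma[OF G lip, of z' z] unfolding smooth b_def u_def by linarith
  also have "\<dots> = h z + c * a\<^sup>2 - (c - e) * (a\<^sup>2 + b\<^sup>2) - c * b\<^sup>2"
    by (simp add: algebra_simps)
  finally show ?thesis
    unfolding coeff c_def[symmetric] a_def b_def u_def by simp
qed

text \<open>
  Since \<open>\<beta> G z = w - (z' - z)\<close>, the gradient is controlled by the two increments, hence so is
  the gap by the Polyak-Lojasiewicz inequality, hence the whole energy. The energy is therefore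
  comparable with its own decrease. The factor does not depend on the points, so that it serves
  all steps at once.
\<close>

lemma energy_contraction:
  fixes h :: "'a::real_inner \<Rightarrow> real"
  assumes G: "\<And>z. GDERIV h z :> G z" and lip: "L-lipschitz_on UNIV G" and "L > 0"
    and "\<gamma> > 0" and sqc: "strongly_quasiconvex \<gamma> h" and min: "\<And>z. h m \<le> h z"
    and "\<beta> > 0" and "0 \<le> \<rho>" and \<rho>: "2 * \<rho> + L * \<beta> < 2"
  obtains q where "0 < q" "q < 1"
    "\<And>z z' w (d::'a). \<lbrakk>norm w \<le> \<rho> * norm d; z' - z = w - \<beta> *\<^sub>R G z\<rbrakk> \<Longrightarrow>
      h z' - h m + (2 - L * \<beta>) / (4 * \<beta>) * (norm (z' - z))\<^sup>2
        \<le> q * (h z - h m + (2 - L * \<beta>) / (4 * \<beta>) * (norm d)\<^sup>2)"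
proof -
  define c \<delta> where "c = (2 - L * \<beta>) / (4 * \<beta>)" and "\<delta> = (2 - L * \<beta> - 2 * \<rho>) / (4 * \<beta>)"
  define K where "K = 2 * L / \<gamma>\<^sup>2 * (2 / \<beta>\<^sup>2)"
  have "L * \<beta> > 0" using \<open>L > 0\<close> \<open>\<beta> > 0\<close> by simp
  then have "\<rho> < 1" using \<rho> by linarith
  have "\<delta> > 0" "K > 0"
    using \<rho> \<open>L > 0\<close> \<open>\<gamma> > 0\<close> \<open>\<beta> > 0\<close> by (simp_all add: \<delta>_def K_def)
  have "\<delta> \<le> c"
    using \<open>\<beta> > 0\<close> \<open>0 \<le> \<rho>\<close> by (simp add: \<delta>_def c_def divide_right_mono)
  with \<open>\<delta> > 0\<close> have "c > 0" by simp
  define q where "q = 1 - \<delta> / (K + c)"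
  have "0 < q" "q < 1"
    using \<open>\<delta> > 0\<close> \<open>\<delta> \<le> c\<close> \<open>K > 0\<close> by (simp_all add: q_def)
  moreover have "h z' - h m + c * (norm (z' - z))\<^sup>2 \<le> q * (h z - h m + c * (norm d)\<^sup>2)"
    if w: "norm w \<le> \<rho> * norm d" and step: "z' - z = w - \<beta> *\<^sub>R G z" for z z' w and d :: 'a
  proof -
    define S where "S = (norm d)\<^sup>2 + (norm (z' - z))\<^sup>2"
    have "\<beta> *\<^sub>R G z = w - (z' - z)" using step by simp
    then have "\<beta> * norm (G z) = norm (w - (z' - z))"
      using \<open>\<beta> > 0\<close> by (metis abs_of_pos norm_scaleR)
    also have "\<dots> \<le> norm w + norm (z' - z)" by (rule norm_triangle_ineq4)
    also have "norm w \<le> norm d"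
      using w \<open>\<rho> < 1\<close> mult_right_mono[of \<rho> 1 "norm d"] by simp
    finally have "(\<beta> * norm (G z))\<^sup>2 \<le> (norm d + norm (z' - z))\<^sup>2"
      using \<open>\<beta> > 0\<close> by (intro power_mono) auto
    also have "\<dots> \<le> 2 * S"
      using sum_squares_bound[of "norm d" "norm (z' - z)"] by (simp add: S_def power2_sum)
    finally have "(norm (G z))\<^sup>2 \<le> 2 / \<beta>\<^sup>2 * S"
      using \<open>\<beta> > 0\<close> by (simp add: power_mult_distrib field_simps)
    then have "2 * L / \<gamma>\<^sup>2 * (norm (G z))\<^sup>2 \<le> 2 * L / \<gamma>\<^sup>2 * (2 / \<beta>\<^sup>2 * S)"
      using \<open>L > 0\<close> by (intro mult_left_mono) auto
    then have "h z - h m \<le> K * S"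
      using strongly_quasiconvex_polyak_lojasiewicz
          [OF G lip \<open>L > 0\<close> \<open>\<gamma> > 0\<close> sqc min, of z]
      by (simp add: K_def)
    moreover have "c * (norm d)\<^sup>2 \<le> c * S"
      using \<open>c > 0\<close> by (simp add: S_def)
    ultimately have "h z - h m + c * (norm d)\<^sup>2 \<le> (K + c) * S"
      by (simp add: algebra_simps)
    then have "\<delta> / (K + c) * (h z - h m + c * (norm d)\<^sup>2) \<le> \<delta> / (K + c) * ((K + c) * S)"
      using \<open>\<delta> > 0\<close> \<open>K > 0\<close> \<open>c > 0\<close> by (intro mult_left_mono) auto
    also have "\<dots> = \<delta> * S" using \<open>K > 0\<close> \<open>c > 0\<close> by simp
    finally have "\<delta> / (K + c) * (h z - h m + c * (norm d)\<^sup>2) \<le> \<delta> * S" .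
    moreover have "h z' + c * (norm (z' - z))\<^sup>2 \<le> h z + c * (norm d)\<^sup>2 - \<delta> * S"
      using energy_decrease[OF G lip \<open>\<beta> > 0\<close> w \<open>0 \<le> \<rho>\<close> step]
      by (simp add: c_def \<delta>_def S_def)
    ultimately show ?thesis
      by (simp add: q_def left_diff_distrib)
  qed
  ultimately show thesis
    by (rule that[folded c_def])
qed

section \<open>Linear convergence\<close>

text \<open>
  For fixed \<open>\<alpha>\<close> and \<open>\<theta>\<close> the worst \<open>\<beta>\<close> is the largest one, \<open>L \<beta> = 1 - 2 \<alpha>\<^sup>2 - \<theta> L\<close>, where the claim
  becomes \<open>2 \<alpha> + \<theta> L - 2 \<alpha>\<^sup>2 < 1\<close>. With \<open>\<theta> L < \<alpha> / \<surd>3 < 3/5 \<alpha>\<close> this follows from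
  \<open>13/5 \<alpha> - 2 \<alpha>\<^sup>2 < 1\<close>, a quadratic in \<open>\<alpha>\<close> with negative discriminant.
\<close>

lemma momentum_bound:
  fixes L \<alpha> \<theta> \<beta> :: real
  assumes "L > 0" and "\<alpha> \<ge> 0" and "\<theta> < \<alpha> / (L * sqrt 3)"
    and "\<theta> + \<beta> \<le> (1 - 2 * \<alpha>\<^sup>2) / L"
  shows "2 * (\<alpha> + \<theta> * L) + L * \<beta> < 2"
proof -
  have "\<theta> * L < \<alpha> / sqrt 3"
    using assms(1,3) by (simp add: field_simps)
  also have "\<alpha> / sqrt 3 \<le> 3 / 5 * \<alpha>"
  proof -
    have "5 / 3 \<le> sqrt 3" by (rule real_le_rsqrt) (simp add: power2_eq_square)
    then have "\<alpha> * (5 / 3) \<le> \<alpha> * sqrt 3" using \<open>\<alpha> \<ge> 0\<close> by (rule mult_left_mono)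
    then show ?thesis by (simp add: field_simps)
  qed
  finally have "\<theta> * L < 3 / 5 * \<alpha>" .
  moreover have "\<theta> * L + L * \<beta> \<le> 1 - 2 * \<alpha>\<^sup>2"
    using assms(1,4) by (simp add: field_simps)
  moreover have "13 / 5 * \<alpha> - 2 * \<alpha>\<^sup>2 < 1"
  proof -
    have "2 * (\<alpha> - 13 / 20)\<^sup>2 \<ge> 0" by simp
    then show ?thesis by (simp add: power2_eq_square algebra_simps)
  qed
  ultimately show ?thesis by (simp add: algebra_simps)
qed

lemma geometric_decay:
  fixes E :: "nat \<Rightarrow> real"
  assumes "\<And>k. E (Suc k) \<le> q * E k" and "q \<ge> 0"
  shows "E k \<le> E 0 * q ^ k"
proof (induction k)
  case (Suc k)
  have "E (Suc k) \<le> q * E k" by (rule assms(1))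
  also have "\<dots> \<le> q * (E 0 * q ^ k)" using Suc \<open>q \<ge> 0\<close> by (rule mult_left_mono)
  finally show ?case by (simp add: mult_ac)
qed simp

theorem theorem13:
  fixes h :: "real ^ 'n \<Rightarrow> real"
    and L \<gamma> \<alpha> \<theta> \<beta> :: real
    and xbar :: "real ^ 'n"
    and x :: "int \<Rightarrow> real ^ 'n"
    and y :: "nat \<Rightarrow> real ^ 'n"
  assumes "\<And>z. h differentiable (at z)"
    and "L > 0" and "L-lipschitz_on UNIV (gradient h)"
    and "\<gamma> > 0" and "strongly_quasiconvex \<gamma> h"
    and "is_arg_min h (\<lambda>_. True) xbar"
    and "\<alpha> \<in> {0..<sqrt 2 / 2}"
    and "\<theta> \<in> {0..<\<alpha> / (L * sqrt 3)}"
    and "\<beta> > 0" and "\<beta> > \<theta> * (sqrt 2 - 1)"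
    and "\<theta> + \<beta> \<in> {0<..(1 - 2 * \<alpha>\<^sup>2) / L}"
    and "\<And>k::nat. y k = x (int k) + \<alpha> *\<^sub>R (x (int k) - x (int k - 1))
           - \<theta> *\<^sub>R (gradient h (x (int k)) - gradient h (x (int k - 1)))"
    and "\<And>k::nat. x (int k + 1) = y k - \<beta> *\<^sub>R gradient h (x (int k))"
  shows "converges_linearly (\<lambda>k. x (int k)) xbar
       \<and> converges_linearly (\<lambda>k. h (x (int k))) (h xbar)"
proof -
  note lip = assms(3)
  have G: "\<And>z. GDERIV h z :> gradient h z"
    using assms(1) by (rule GDERIV_gradient)
  have min: "\<And>z. h xbar \<le> h z"
    using assms(6) by (simp add: is_arg_min_linorder)
  have \<alpha>: "0 \<le> \<alpha>" and \<theta>: "0 \<le> \<theta>" using assms(7,8) by auto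
  define \<rho> where "\<rho> = \<alpha> + \<theta> * L"
  have "0 \<le> \<rho>" using \<alpha> \<theta> \<open>L > 0\<close> by (simp add: \<rho>_def)
  have \<rho>: "2 * \<rho> + L * \<beta> < 2"
    unfolding \<rho>_def using momentum_bound[OF \<open>L > 0\<close> \<alpha>] assms(8,11) by simp
  define c where "c = (2 - L * \<beta>) / (4 * \<beta>)"
  have "c \<ge> 0"
    using \<rho> \<open>0 \<le> \<rho>\<close> \<open>\<beta> > 0\<close> by (simp add: c_def)
  obtain q where q: "0 < q" "q < 1"
    and contract: "\<And>z z' w (d :: real ^ 'n).
      \<lbrakk>norm w \<le> \<rho> * norm d; z' - z = w - \<beta> *\<^sub>R gradient h z\<rbrakk> \<Longrightarrow>
      h z' - h xbar + c * (norm (z' - z))\<^sup>2 \<le> q * (h z - h xbar + c * (norm d)\<^sup>2)"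
    using energy_contraction
        [OF G lip \<open>L > 0\<close> \<open>\<gamma> > 0\<close> assms(5) min \<open>\<beta> > 0\<close> \<open>0 \<le> \<rho>\<close> \<rho>]
    unfolding c_def by blast
  define E where "E k = h (x (int k)) - h xbar + c * (norm (x (int k) - x (int k - 1)))\<^sup>2" for k
  have "E (Suc k) \<le> q * E k" for k
  proof -
    define d where "d = x (int k) - x (int k - 1)"
    define e where "e = gradient h (x (int k)) - gradient h (x (int k - 1))"
    have "norm (\<alpha> *\<^sub>R d - \<theta> *\<^sub>R e) \<le> \<alpha> * norm d + \<theta> * norm e"
      using norm_triangle_ineq4[of "\<alpha> *\<^sub>R d" "\<theta> *\<^sub>R e"] \<alpha> \<theta> by simp
    also have "\<dots> \<le> \<alpha> * norm d + \<theta> * (L * norm d)"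
      using lipschitz_onD[OF lip, of "x (int k)" "x (int k - 1)"] \<theta>
      by (intro add_left_mono mult_left_mono) (auto simp: d_def e_def dist_norm)
    also have "\<dots> = \<rho> * norm d" by (simp add: \<rho>_def algebra_simps)
    finally have w: "norm (\<alpha> *\<^sub>R d - \<theta> *\<^sub>R e) \<le> \<rho> * norm d" .
    have "x (int k + 1) - x (int k) = (\<alpha> *\<^sub>R d - \<theta> *\<^sub>R e) - \<beta> *\<^sub>R gradient h (x (int k))"
      by (simp add: assms(12,13) d_def e_def)
    from contract[OF w this] show ?thesis
      by (simp add: E_def d_def add.commute)
  qed
  then have decay: "E k \<le> E 0 * q ^ k" for k
    using q by (intro geometric_decay) auto
  have gap_le: "h (x (int k)) - h xbar \<le> E k" for k
    using \<open>c \<ge> 0\<close> by (simp add: E_def)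
  have "E 0 \<ge> 0"
    using min \<open>c \<ge> 0\<close> by (simp add: E_def)
  have "norm (h (x (int k)) - h xbar) \<le> E 0 * q ^ k" for k
    using decay[of k] gap_le[of k] min[of "x (int k)"] by simp
  then have gap_conv: "converges_linearly (\<lambda>k. h (x (int k))) (h xbar)"
    unfolding converges_linearly_def
    using q \<open>E 0 \<ge> 0\<close> by (intro exI[of _ "E 0"] conjI bexI[of _ q]) auto
  have "norm (x (int k) - xbar) \<le> sqrt (8 / \<gamma> * E 0) * sqrt q ^ k" for k
  proof -
    have "\<gamma> / 8 * (norm (x (int k) - xbar))\<^sup>2 \<le> E 0 * q ^ k"
      using strongly_quasiconvex_quadratic_growth[OF assms(5) min, of "x (int k)"]
        decay[of k] gap_le[of k] by linarith
    then have "(norm (x (int k) - xbar))\<^sup>2 \<le> 8 / \<gamma> * E 0 * q ^ k"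
      using \<open>\<gamma> > 0\<close> by (simp add: field_simps)
    then have "norm (x (int k) - xbar) \<le> sqrt (8 / \<gamma> * E 0 * q ^ k)"
      by (rule real_le_rsqrt)
    then show ?thesis by (simp only: real_sqrt_mult real_sqrt_power)
  qed
  moreover have "sqrt (8 / \<gamma> * E 0) \<ge> 0" "sqrt q \<in> {0<..<1}"
    using q \<open>E 0 \<ge> 0\<close> \<open>\<gamma> > 0\<close> by auto
  ultimately have "converges_linearly (\<lambda>k. x (int k)) xbar"
    unfolding converges_linearly_def by blast
  with gap_conv show ?thesis by blast
qed

end
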